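(* Let $F$ be an oriented star of degree at least $5$, and let $H$ be a digraph. If $\{H, F\}$ is $\vec{\chi}$-finite, then $H$ is a transitive tournament.
   Context: All digraphs are finite, loopless, and between any two distinct vertices $u,v$ at most one of the arcs $uv$, $vu$ is present. A digraph $D$ is $H$-free if no induced subdigraph of $D$ is isomorphic to $H$, and $\mathcal{F}$-free if it is $H$-free for every $H \in \mathcal{F}$. A $k$-dicolouring of $D$ is a map $f: V(D) \to \{1,\dots,k\}$ such that each colour class induces an acyclic subdigraph (contains no directed cycle); the dichromatic number $\vec{\chi}(D)$ is the least $k$ for which a $k$-dicolouring exists. A finite family $\mathcal{F}$ of digraphs is $\vec{\chi}$-finite if there is a constant $c$ such that every $\mathcal{F}$-free digraph has dichromatic number at most $c$. An oriented star of degree $t$ is an orientation of the complete bipartite graph $K_{1,t}$. A tournament is an orientation of a complete graph; it is transitive if it is acyclic. *)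

theory Defs
  imports "Graph_Theory.Graph_Theory"
begin

text \<open>
  A loopless digraph without parallel arcs is an element of type \<^typ>\<open>'a pair_pre_digraph\<close>
  satisfying the library locale \<^locale>\<open>pair_digraph\<close> (which includes finiteness); what remains
  to be excluded are the 2-cycles. The null digraph is allowed.
\<close>

locale oriented_digraph = pair_digraph G for G :: "'a pair_pre_digraph" +
  assumes no_antiparallel_arcs: "(u, v) \<in> parcs G \<Longrightarrow> (v, u) \<notin> parcs G"

definition acyclic_digraph :: "('a, 'b) pre_digraph \<Rightarrow> bool" where
  "acyclic_digraph G \<longleftrightarrow> \<not> (\<exists>p. pre_digraph.cycle G p)"

definition H_free :: "'a pair_pre_digraph \<Rightarrow> 'b pair_pre_digraph \<Rightarrow> bool" where
  "H_free H D \<longleftrightarrow>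
     \<not> (\<exists>K. induced_subgraph K (with_proj D) \<and> digraph_iso (with_proj H) K)"

definition family_free :: "'a pair_pre_digraph set \<Rightarrow> 'b pair_pre_digraph \<Rightarrow> bool" where
  "family_free \<F> D \<longleftrightarrow> (\<forall>H\<in>\<F>. H_free H D)"

definition dicolouring :: "'a pair_pre_digraph \<Rightarrow> nat \<Rightarrow> ('a \<Rightarrow> nat) \<Rightarrow> bool" where
  "dicolouring D k f \<longleftrightarrow> f ` pverts D \<subseteq> {1..k} \<and>
     (\<forall>i\<in>{1..k}. acyclic_digraph (with_proj D \<restriction> {v \<in> pverts D. f v = i}))"

definition dichromatic_number :: "'a pair_pre_digraph \<Rightarrow> nat" where
  "dichromatic_number D = (LEAST k. \<exists>f. dicolouring D k f)"

text \<open>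
  Digraphs are finite, so each of them is isomorphic to one whose vertices are natural numbers;
  hence letting \<open>D\<close> range over \<^typ>\<open>nat pair_pre_digraph\<close> covers all digraphs.
\<close>

definition dichi_finite :: "'a pair_pre_digraph set \<Rightarrow> bool" where
  "dichi_finite \<F> \<longleftrightarrow> finite \<F> \<and>
     (\<exists>c. \<forall>D :: nat pair_pre_digraph.
        oriented_digraph D \<and> family_free \<F> D \<longrightarrow> dichromatic_number D \<le> c)"

text \<open>
  The library represents undirected graphs as symmetric digraphs, so
  \<^term>\<open>mk_symmetric (with_proj D)\<close> is the underlying undirected graph of \<open>D\<close>, and an oriented
  digraph is an orientation of exactly that graph.
\<close>

definition oriented_star :: "nat \<Rightarrow> 'a pair_pre_digraph \<Rightarrow> bool" where
  "oriented_star t D \<longleftrightarrow> oriented_digraph D \<and>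
     complete_bipartite_digraph 1 t (with_proj (mk_symmetric (with_proj D)))"

definition tournament :: "'a pair_pre_digraph \<Rightarrow> bool" where
  "tournament D \<longleftrightarrow> oriented_digraph D \<and>
     (\<exists>n. complete_digraph n (with_proj (mk_symmetric (with_proj D))))"

definition transitive_tournament :: "'a pair_pre_digraph \<Rightarrow> bool" where
  "transitive_tournament D \<longleftrightarrow> tournament D \<and> acyclic_digraph (with_proj D)"

end

theory Submission
  imports Defs "HOL-Combinatorics.Multiset_Permutations"
    "HOL-Number_Theory.Cong"
begin

text \<open>
  If \<open>H\<close> is not a tournament, then all tournaments are free of \<open>H\<close> and of \<open>F\<close>; but in the \<open>k\<close>-fold
  iterated directed triangle, on \<open>3\<^sup>k\<close> vertices, acyclic sets have at most \<open>2\<^sup>k\<close> elements.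
  If \<open>H\<close> is a tournament that is not transitive, then it contains a directed triangle. Take the
  points of \<open>(\<int>/n)\<^sup>3\<close>, the lines in the directions \<open>(1,0,0)\<close>, \<open>(0,1,0)\<close>, \<open>(0,0,1)\<close>, \<open>(1,1,1)\<close>, and make
  every line a transitive tournament. Any three of the directions are independent, so all triangles
  lie within lines and none is directed; a neighbourhood is covered by four cliques, so
  there is no induced star of degree 5. There are \<open>n!\<close> orders on each of the \<open>4n\<^sup>2\<close> lines,
  hence \<open>n\<close> to the power \<open>(4 - o(1))n\<^sup>3\<close> such digraphs, while only \<open>(c\<^sup>5n\<^sup>3)\<close> to the power \<open>n\<^sup>3\<close> of them
  can have a dicolouring with \<open>c\<close> colours: on a line the order is given by the sequence of colours
  and a topological sorting of the colour classes.
\<close>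

section \<open>Digraphs as relations\<close>

text \<open>A closed walk of positive length contains a cycle, so it makes no difference that
  \<open>acyclic\<close> speaks of closed walks instead.\<close>

lemma acyclic_digraph_iff_acyclic:
  assumes "wf_digraph G"
  shows "acyclic_digraph G \<longleftrightarrow> acyclic (arcs_ends G)"
proof -
  interpret wf_digraph G by fact
  show ?thesis
    unfolding acyclic_digraph_def acyclic_def
    using closed_w_imp_cycle by (auto simp: reachable1_awalk closed_w_def cycle_def)
qed

text \<open>The equivalence on arcs makes the copy of \<open>H\<close> induced. The host is a bare
  set with a relation, so its vertices may be of any type, such as triples of numbers.\<close>

definition embeds :: "'a pair_pre_digraph \<Rightarrow> 'b set \<Rightarrow> 'b rel \<Rightarrow> bool" where
  "embeds H V R \<longleftrightarrow> (\<exists>g. inj_on g (pverts H) \<and> g ` pverts H \<subseteq> V \<and>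
     (\<forall>u\<in>pverts H. \<forall>v\<in>pverts H. (u, v) \<in> parcs H \<longleftrightarrow> (g u, g v) \<in> R))"

lemma H_free_if_not_embeds:
  assumes "pair_wf_digraph H" and "\<not> embeds H (pverts D) (parcs D)"
  shows "H_free H D"
  unfolding H_free_def
proof
  interpret pair_wf_digraph H by fact
  assume "\<exists>K. induced_subgraph K (with_proj D) \<and> digraph_iso (with_proj H) K"
  then obtain f where sub: "induced_subgraph (app_iso f (with_proj H)) (with_proj D)"
    and iso: "pre_digraph.digraph_isomorphism (with_proj H) f"
    by (auto simp: digraph_iso_def)
  let ?g = "iso_verts f"
  \<comment> \<open>A subgraph shares the tail and head maps of \<open>D\<close>, here the
    projections of pairs. Hence the vertex map alone determines the arc map.\<close>
  have proj: "iso_tail f = fst" "iso_head f = snd"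
    using sub by (auto simp: induced_subgraph_def subgraph_def compatible_def app_iso_def with_proj_def)
  have inj: "inj_on ?g (pverts H)"
    using iso by (simp add: pre_digraph.digraph_isomorphism_def)
  have arcs: "iso_arcs f a = (?g (fst a), ?g (snd a))" if "a \<in> parcs H" for a
    using iso that proj by (auto simp: pre_digraph.digraph_isomorphism_def prod_eq_iff)
  have im: "iso_arcs f ` parcs H
      = {e \<in> parcs D. fst e \<in> ?g ` pverts H \<and> snd e \<in> ?g ` pverts H}"
    using sub by (auto simp: induced_subgraph_def app_iso_def)
  have "(u, v) \<in> parcs H \<longleftrightarrow> (?g u, ?g v) \<in> parcs D"
    if uv: "u \<in> pverts H" "v \<in> pverts H" for u v
  proof
    assume "(u, v) \<in> parcs H"
    then have "iso_arcs f (u, v) \<in> iso_arcs f ` parcs H" by blast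
    with im arcs[OF \<open>(u, v) \<in> parcs H\<close>] show "(?g u, ?g v) \<in> parcs D" by auto
  next
    assume "(?g u, ?g v) \<in> parcs D"
    with uv im have "(?g u, ?g v) \<in> iso_arcs f ` parcs H" by auto
    then obtain a where a: "a \<in> parcs H" "(?g u, ?g v) = iso_arcs f a" by blast
    with arcs have "?g u = ?g (fst a)" "?g v = ?g (snd a)" by auto
    then have "u = fst a" "v = snd a"
      using inj uv a(1) arc_fst_in_verts arc_snd_in_verts by (auto dest: inj_onD)
    with a(1) show "(u, v) \<in> parcs H" by simp
  qed
  moreover have "?g ` pverts H \<subseteq> pverts D"
    using sub by (auto simp: induced_subgraph_def subgraph_def app_iso_def)
  ultimately show False
    using assms(2) inj unfolding embeds_def by blast
qed

section \<open>Rank functions as certificates of acyclicity\<close>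

lemma acyclic_rank:
  assumes "finite S" and "acyclic R" and "R \<subseteq> S \<times> S"
  obtains r :: "'b \<Rightarrow> nat" where "r ` S \<subseteq> {..<card S}"
    and "\<And>u v. (u, v) \<in> R \<Longrightarrow> r u < r v"
proof
  \<comment> \<open>The rank counts strict predecessors. A vertex is not its own predecessor, which
    gives the bound by \<open>card S\<close>; along an arc from \<open>u\<close> to \<open>v\<close>
    the predecessors of \<open>u\<close> are inherited and \<open>u\<close> itself is added.\<close>
  define r where "r v = card {u. (u, v) \<in> R\<^sup>+}" for v
  have sub: "{u. (u, v) \<in> R\<^sup>+} \<subseteq> S" for v
    using trancl_subset_Sigma[OF assms(3)] by blast
  have fin: "finite {u. (u, v) \<in> R\<^sup>+}" for v
    using sub assms(1) by (rule finite_subset)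
  show "r ` S \<subseteq> {..<card S}"
  proof
    fix i assume "i \<in> r ` S"
    then obtain v where v: "v \<in> S" "i = r v" by blast
    have "{u. (u, v) \<in> R\<^sup>+} \<subset> S"
      using sub v assms(2) by (auto simp: acyclic_def)
    with assms(1) v show "i \<in> {..<card S}"
      by (simp add: r_def psubset_card_mono)
  qed
  show "r u < r v" if uv: "(u, v) \<in> R" for u v
    unfolding r_def
  proof (rule psubset_card_mono[OF fin])
    have "u \<notin> {w. (w, u) \<in> R\<^sup>+}" "u \<in> {w. (w, v) \<in> R\<^sup>+}"
      using assms(2) uv by (auto simp: acyclic_def)
    moreover have "{w. (w, u) \<in> R\<^sup>+} \<subseteq> {w. (w, v) \<in> R\<^sup>+}"
      using uv by auto
    ultimately show "{w. (w, u) \<in> R\<^sup>+} \<subset> {w. (w, v) \<in> R\<^sup>+}" by blast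
  qed
qed

text \<open>
  A dicolouring of \<open>(V, R)\<close> together with a map \<open>r\<close> that increases along the monochromatic arcs
  and thereby certifies that the colour classes are acyclic.
\<close>

definition ranked_dicolouring ::
    "'b set \<Rightarrow> 'b rel \<Rightarrow> nat \<Rightarrow> ('b \<Rightarrow> nat) \<Rightarrow> ('b \<Rightarrow> nat) \<Rightarrow> bool" where
  "ranked_dicolouring V R k f r \<longleftrightarrow> f ` V \<subseteq> {1..k} \<and> r ` V \<subseteq> {..<card V} \<and>
     (\<forall>(u, v)\<in>R. f u = f v \<longrightarrow> r u < r v)"

text \<open>The \<open>LEAST\<close> is attained because some dicolouring exists: give all vertices
  different colours. The \<open>Suc\<close> is there because colours start at 1.\<close>

lemma ex_dicolouring_dichromatic_number:
  assumes "pair_digraph D"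
  shows "\<exists>f. dicolouring D (dichromatic_number D) f"
proof -
  interpret pair_digraph D by fact
  from ex_bij_betw_finite_nat[OF pair_finite_verts] obtain h
    where h: "bij_betw h (pverts D) {0..<card (pverts D)}" by blast
  have "acyclic_digraph (with_proj D \<restriction> {v \<in> pverts D. Suc (h v) = i})" for i
  proof -
    have eq: "u = v" if "Suc (h u) = i" "Suc (h v) = i" "u \<in> pverts D" "v \<in> pverts D" for u v
      using h that by (metis bij_betw_inv_into_left old.nat.inject)
    have "arcs_ends (with_proj D \<restriction> {v \<in> pverts D. Suc (h v) = i}) = {}"
      using eq pair_no_loops by (fastforce simp: arcs_ends_conv)
    then show ?thesis
      using wellformed_induce_subgraph by (simp add: acyclic_digraph_iff_acyclic acyclic_def)
  qed
  moreover have "(\<lambda>v. Suc (h v)) ` pverts D \<subseteq> {1..card (pverts D)}"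
    using bij_betwE[OF h] by (auto simp: Suc_le_eq)
  ultimately have "dicolouring D (card (pverts D)) (\<lambda>v. Suc (h v))"
    by (simp add: dicolouring_def)
  then have "\<exists>k f. dicolouring D k f" by blast
  then show ?thesis
    unfolding dichromatic_number_def by (rule LeastI_ex)
qed

text \<open>The monochromatic arcs of all colours together form an acyclic relation, so a single
  rank function serves all colour classes.\<close>

lemma ranked_dicolouring_if_dichromatic_number_le:
  assumes "pair_digraph D" and "dichromatic_number D \<le> k"
  shows "\<exists>f r. ranked_dicolouring (pverts D) (parcs D) k f r"
proof -
  interpret pair_digraph D by fact
  obtain f where f: "dicolouring D (dichromatic_number D) f"
    using ex_dicolouring_dichromatic_number[OF assms(1)] by blast
  define R where "R = {(u, v) \<in> parcs D. f u = f v}"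
  have "acyclic R"
  proof (rule acyclicI, clarify)
    fix x assume x: "(x, x) \<in> R\<^sup>+"
    let ?C = "{v \<in> pverts D. f v = f x}"
    \<comment> \<open>A walk along monochromatic arcs never changes colour, so a closed walk through
      \<open>x\<close> stays in the colour class of \<open>x\<close>.\<close>
    have "(u, v) \<in> (R \<inter> ?C \<times> ?C)\<^sup>+" if "(u, v) \<in> R\<^sup>+" "f v = f x" for u v
      using that
    proof (induction rule: converse_trancl_induct)
      case (base y)
      then show ?case by (auto simp: R_def in_arcsD1 in_arcsD2)
    next
      case (step y z)
      have "f z = f x" using step.hyps(2) step.prems
        by (induction rule: converse_trancl_induct) (auto simp: R_def)
      with step have "(y, z) \<in> R \<inter> ?C \<times> ?C" by (auto simp: R_def in_arcsD1 in_arcsD2)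
      with step show ?case by (meson trancl_into_trancl2)
    qed
    with x have "\<not> acyclic (R \<inter> ?C \<times> ?C)" by (auto simp: acyclic_def)
    moreover have "R \<inter> ?C \<times> ?C \<subseteq> arcs_ends (with_proj D \<restriction> ?C)"
      by (auto simp: R_def arcs_ends_conv image_iff)
    ultimately have "\<not> acyclic_digraph (with_proj D \<restriction> ?C)"
      using wellformed_induce_subgraph acyclic_subset by (auto simp: acyclic_digraph_iff_acyclic)
    moreover have "x \<in> pverts D"
      using x by (auto simp: R_def in_arcsD1 elim: converse_tranclE)
    ultimately show False
      using f by (auto simp: dicolouring_def)
  qed
  moreover have "R \<subseteq> pverts D \<times> pverts D"
    by (auto simp: R_def in_arcsD1 in_arcsD2)
  ultimately obtain r where r: "r ` pverts D \<subseteq> {..<card (pverts D)}"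
    "\<And>u v. (u, v) \<in> R \<Longrightarrow> r u < r v"
    using acyclic_rank[OF pair_finite_verts] by blast
  have "f ` pverts D \<subseteq> {1..dichromatic_number D}"
    using f by (simp add: dicolouring_def)
  also have "\<dots> \<subseteq> {1..k}" using assms(2) by simp
  finally have "ranked_dicolouring (pverts D) (parcs D) k f r"
    using r by (auto simp: ranked_dicolouring_def R_def)
  then show ?thesis by blast
qed

text \<open>The bound in \<open>dichi_finite\<close> concerns digraphs on natural numbers. Numbering
  the vertices of a finite set carries it over to hosts of any type.\<close>

lemma dichi_finite_ranked_dicolouring:
  fixes \<F> :: "'a pair_pre_digraph set"
  assumes "dichi_finite \<F>" and wf: "\<And>H. H \<in> \<F> \<Longrightarrow> pair_wf_digraph H"
  obtains c where "\<And>(V :: 'b set) R. \<lbrakk>finite V; R \<subseteq> V \<times> V; asym R;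
      \<And>H. H \<in> \<F> \<Longrightarrow> \<not> embeds H V R\<rbrakk> \<Longrightarrow> \<exists>f r. ranked_dicolouring V R c f r"
proof -
  obtain c where c: "\<And>D :: nat pair_pre_digraph.
      oriented_digraph D \<Longrightarrow> family_free \<F> D \<Longrightarrow> dichromatic_number D \<le> c"
    using assms(1) by (auto simp: dichi_finite_def)
  have "\<exists>f r. ranked_dicolouring V R c f r"
    if V: "finite V" and R: "R \<subseteq> V \<times> V" and asym: "asym R"
      and free: "\<And>H. H \<in> \<F> \<Longrightarrow> \<not> embeds H V R"
    for V :: "'b set" and R
  proof -
    from ex_bij_betw_finite_nat[OF V] obtain h where "bij_betw h V {0..<card V}" by blast
    then have h: "inj_on h V" by (rule bij_betw_imp_inj_on)
    define D where "D = \<lparr>pverts = h ` V, parcs = map_prod h h ` R\<rparr>"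
    have arc: "(h u, h v) \<in> parcs D \<longleftrightarrow> (u, v) \<in> R" if "u \<in> V" "v \<in> V" for u v
    proof
      assume "(h u, h v) \<in> parcs D"
      then obtain u' v' where "(u', v') \<in> R" "h u = h u'" "h v = h v'"
        by (auto simp: D_def)
      moreover from this have "u = u'" "v = v'" using R that inj_on_eq_iff[OF h] by auto
      ultimately show "(u, v) \<in> R" by simp
    qed (force simp: D_def)
    have D: "oriented_digraph D"
    proof unfold_locales
      show "finite (parcs D)"
        using finite_subset[OF R] V by (simp add: D_def)
      show "(v, u) \<notin> parcs D" if "(u, v) \<in> parcs D" for u v
      proof -
        from that obtain a b where ab: "u = h a" "v = h b" "(a, b) \<in> R" by (auto simp: D_def)
        with asym have "(b, a) \<notin> R" by (blast dest: asymD)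
        with ab R arc show ?thesis by blast
      qed
      show "fst e \<noteq> snd e" if "e \<in> parcs D" for e
      proof -
        from that obtain u v where "e = (h u, h v)" "(u, v) \<in> R" by (auto simp: D_def)
        moreover from this have "u \<noteq> v" using asym by (blast dest: asymD)
        ultimately show ?thesis using R inj_on_eq_iff[OF h] by auto
      qed
    qed (use R V in \<open>auto simp: D_def\<close>)
    have "H_free H D" if H: "H \<in> \<F>" for H
    proof (rule H_free_if_not_embeds[OF wf[OF H]])
      show "\<not> embeds H (pverts D) (parcs D)"
      proof
        assume "embeds H (pverts D) (parcs D)"
        then obtain g where g: "inj_on g (pverts H)" "g ` pverts H \<subseteq> h ` V"
          "\<And>u v. u \<in> pverts H \<Longrightarrow> v \<in> pverts H \<Longrightarrow>
             (u, v) \<in> parcs H \<longleftrightarrow> (g u, g v) \<in> parcs D"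
          unfolding embeds_def D_def by auto
        \<comment> \<open>A copy of \<open>H\<close> in the renumbered digraph is pulled back along
          \<open>h\<close>.\<close>
        let ?g = "\<lambda>u. inv_into V h (g u)"
        have hg: "h (?g u) = g u" "?g u \<in> V" if "u \<in> pverts H" for u
          using g(2) that by (auto simp: f_inv_into_f inv_into_into)
        have "inj_on ?g (pverts H)"
        proof (rule inj_onI)
          fix u v assume "u \<in> pverts H" "v \<in> pverts H" "?g u = ?g v"
          then show "u = v" using hg(1) inj_onD[OF g(1)] by metis
        qed
        moreover have "(u, v) \<in> parcs H \<longleftrightarrow> (?g u, ?g v) \<in> R"
          if "u \<in> pverts H" "v \<in> pverts H" for u v
          using g(3)[OF that] arc[of "?g u" "?g v"] hg that by simp
        ultimately have "embeds H V R"
          using hg(2) unfolding embeds_def by blast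
        with free H show False by blast
      qed
    qed
    then have "dichromatic_number D \<le> c"
      using c D by (simp add: family_free_def)
    moreover have "pair_digraph D"
      using D by (simp add: oriented_digraph_def)
    ultimately obtain f r where "ranked_dicolouring (pverts D) (parcs D) c f r"
      using ranked_dicolouring_if_dichromatic_number_le by blast
    then have "f ` h ` V \<subseteq> {1..c}" "r ` h ` V \<subseteq> {..<card V}"
      and "\<And>u v. (u, v) \<in> R \<Longrightarrow> f (h u) = f (h v) \<Longrightarrow> r (h u) < r (h v)"
      using card_image[OF h] by (auto simp: ranked_dicolouring_def D_def)
    then have "ranked_dicolouring V R c (f \<circ> h) (r \<circ> h)"
      by (auto simp: ranked_dicolouring_def)
    then show ?thesis by blast
  qed
  then show ?thesis using that by blast
qed

section \<open>Tournaments and stars in terms of arcs\<close>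

lemma tournament_parcs:
  assumes "oriented_digraph D"
  shows "tournament D \<longleftrightarrow> (\<forall>u\<in>pverts D. \<forall>v\<in>pverts D. u \<noteq> v \<longrightarrow> (u, v) \<in> parcs D \<or> (v, u) \<in> parcs D)"
proof -
  interpret oriented_digraph D by fact
  have "parcs (mk_symmetric (with_proj D)) = parcs D \<union> (parcs D)\<inverse>"
    by (force simp: parcs_mk_symmetric)
  moreover have loop: "(v, v) \<notin> parcs D" for v
    using no_antiparallel_arcs by blast
  ultimately have "tournament D \<longleftrightarrow> parcs D \<union> (parcs D)\<inverse> = {(u, v). (u, v) \<in> pverts D \<times> pverts D \<and> u \<noteq> v}"
    using assms by (auto simp: tournament_def complete_digraph_pair_def)
  also have "\<dots> \<longleftrightarrow> (\<forall>u\<in>pverts D. \<forall>v\<in>pverts D. u \<noteq> v \<longrightarrow> (u, v) \<in> parcs D \<or> (v, u) \<in> parcs D)"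
    using in_arcsD1 in_arcsD2 loop by (auto simp: set_eq_iff)
  finally show ?thesis .
qed

text \<open>Only a centre \<open>x\<close> and the independent set \<open>B\<close> of leaves are
  kept. The directions of the arcs are left open, so all orientations of the star are treated
  alike.\<close>

lemma oriented_star_parcs:
  assumes "oriented_star t D"
  obtains x B where "x \<in> pverts D" "B \<subseteq> pverts D" "card B = t"
    and "\<And>b. b \<in> B \<Longrightarrow> (x, b) \<in> parcs D \<or> (b, x) \<in> parcs D"
    and "\<And>b b'. b \<in> B \<Longrightarrow> b' \<in> B \<Longrightarrow> (b, b') \<notin> parcs D"
proof -
  have sym: "parcs (mk_symmetric (with_proj D)) = parcs D \<union> (parcs D)\<inverse>"
    by (force simp: parcs_mk_symmetric)
  obtain U B where UB: "pverts D = U \<union> B" "U \<inter> B = {}" "card U = 1" "card B = t"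
    "parcs D \<union> (parcs D)\<inverse> = U \<times> B \<union> B \<times> U"
    using assms unfolding oriented_star_def complete_bipartite_digraph_pair_def sym by auto
  then obtain x where x: "U = {x}" by (auto simp: card_1_singleton_iff)
  show thesis
  proof (rule that[of x B])
    show "(x, b) \<in> parcs D \<or> (b, x) \<in> parcs D" if "b \<in> B" for b
      using UB(5) x that by auto
    show "(b, b') \<notin> parcs D" if "b \<in> B" "b' \<in> B" for b b'
      using UB(2,5) that by blast
  qed (use UB x in auto)
qed

text \<open>For consecutive arcs from \<open>a\<close> to \<open>b\<close> to \<open>c\<close>, the
  arc from \<open>c\<close> back to \<open>a\<close> is excluded, so the tournament has the arc from
  \<open>a\<close> to \<open>c\<close>. A transitive relation without loops is acyclic.\<close>

lemma tournament_transitive_if_no_triangle: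
  assumes "tournament D"
    and "\<And>a b c. \<lbrakk>(a, b) \<in> parcs D; (b, c) \<in> parcs D\<rbrakk> \<Longrightarrow> (c, a) \<notin> parcs D"
  shows "transitive_tournament D"
proof -
  have D: "oriented_digraph D" using assms(1) by (simp add: tournament_def)
  interpret oriented_digraph D by (rule D)
  have "trans (parcs D)"
  proof (rule transI)
    fix a b c assume ab: "(a, b) \<in> parcs D" and bc: "(b, c) \<in> parcs D"
    then have "a \<noteq> c" using no_antiparallel_arcs by blast
    moreover have "(c, a) \<notin> parcs D" using ab bc by (rule assms(2))
    ultimately show "(a, c) \<in> parcs D"
      using assms(1) ab bc in_arcsD1 in_arcsD2 unfolding tournament_parcs[OF D] by blast
  qed
  then have "acyclic (parcs D)"
    using pair_no_loops by (force simp: acyclic_def)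
  then have "acyclic_digraph (with_proj D)"
    using wf_digraph by (simp add: acyclic_digraph_iff_acyclic)
  with assms(1) show ?thesis by (simp add: transitive_tournament_def)
qed

section \<open>Iterated directed triangles\<close>

text \<open>Vertices are read in base 3, and the lowest digit in which two of them differ decides
  the arc, following the directed triangle 0, 1, 2. The residue classes mod 3 are thus three copies
  of the previous digraph, placed on a directed triangle.\<close>

fun triangle_power :: "nat \<Rightarrow> nat \<Rightarrow> nat \<Rightarrow> bool" where
  "triangle_power 0 u v \<longleftrightarrow> False"
| "triangle_power (Suc k) u v \<longleftrightarrow>
     (if u mod 3 = v mod 3 then triangle_power k (u div 3) (v div 3)
      else v mod 3 = (u mod 3 + 1) mod 3)"

lemma succ_mod_3:
  fixes a b :: nat
  assumes "a < 3" "b < 3" "a \<noteq> b"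
  shows "b = (a + 1) mod 3 \<longleftrightarrow> a \<noteq> (b + 1) mod 3"
proof -
  have "a = 0 \<or> a = 1 \<or> a = 2" "b = 0 \<or> b = 1 \<or> b = 2" using assms by linarith+
  then show ?thesis using assms(3) by (elim disjE; hypsubst; simp)
qed

lemma triangle_power_asym: "triangle_power k u v \<Longrightarrow> \<not> triangle_power k v u"
proof (induction k arbitrary: u v)
  case (Suc k)
  show ?case
  proof (cases "u mod 3 = v mod 3")
    case True
    with Suc show ?thesis by simp
  next
    case False
    then have "v mod 3 = (u mod 3 + 1) mod 3" using Suc.prems by simp
    then have "u mod 3 \<noteq> (v mod 3 + 1) mod 3"
      using False succ_mod_3[of "u mod 3" "v mod 3"] by simp
    with False show ?thesis by simp
  qed
qed simp

lemma triangle_power_total: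
  "u < 3 ^ k \<Longrightarrow> v < 3 ^ k \<Longrightarrow> u \<noteq> v \<Longrightarrow> triangle_power k u v \<or> triangle_power k v u"
proof (induction k arbitrary: u v)
  case (Suc k)
  show ?case
  proof (cases "u mod 3 = v mod 3")
    case True
    then have "u div 3 \<noteq> v div 3" using Suc.prems(3) by (metis div_mult_mod_eq)
    then have "triangle_power k (u div 3) (v div 3) \<or> triangle_power k (v div 3) (u div 3)"
      using Suc.prems by (intro Suc.IH) auto
    with True show ?thesis by simp
  next
    case False
    then have "v mod 3 = (u mod 3 + 1) mod 3 \<or> u mod 3 = (v mod 3 + 1) mod 3"
      using succ_mod_3[of "u mod 3" "v mod 3"] by simp
    with False show ?thesis by simp
  qed
qed simp

text \<open>An acyclic set misses one of the three residue classes mod 3, since vertices from all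
  three would form a directed triangle. By induction each of the other two classes contributes at
  most \<open>2 ^ k\<close>.\<close>

lemma card_acyclic_triangle_power_le:
  fixes r :: "nat \<Rightarrow> nat"
  assumes "S \<subseteq> {..<3 ^ k}" and "\<And>u v. u \<in> S \<Longrightarrow> v \<in> S \<Longrightarrow> triangle_power k u v \<Longrightarrow> r u < r v"
  shows "card S \<le> 2 ^ k"
  using assms
proof (induction k arbitrary: S r)
  case 0
  then show ?case using card_mono[of "{0}" S] by auto
next
  case (Suc k)
  \<comment> \<open>\<open>T i\<close> consists of the elements of \<open>S\<close> with last digit
    \<open>i\<close>, with that digit removed.\<close>
  define T where "T i = {x. 3 * x + i \<in> S}" for i :: nat
  have finS: "finite S" using Suc.prems(1) finite_subset by blast
  have T: "card (T i) \<le> 2 ^ k" if "i < 3" for i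
  proof (rule Suc.IH[where r = "\<lambda>x. r (3 * x + i)"])
    show "T i \<subseteq> {..<3 ^ k}" using Suc.prems(1) by (force simp: T_def)
    fix u v assume "u \<in> T i" "v \<in> T i" "triangle_power k u v"
    with that show "r (3 * u + i) < r (3 * v + i)"
      by (intro Suc.prems(2)) (auto simp: T_def)
  qed
  have S: "S = (\<Union>i<3. (\<lambda>x. 3 * x + i) ` T i)"
  proof
    show "S \<subseteq> (\<Union>i<3. (\<lambda>x. 3 * x + i) ` T i)"
    proof
      fix x assume "x \<in> S"
      then have "x div 3 \<in> T (x mod 3)" by (simp add: T_def)
      moreover have "x = 3 * (x div 3) + x mod 3" by simp
      ultimately show "x \<in> (\<Union>i<3. (\<lambda>x. 3 * x + i) ` T i)"
        by (intro UN_I[of "x mod 3"] image_eqI[of _ _ "x div 3"]) auto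
    qed
  qed (auto simp: T_def)
  have "card S \<le> (\<Sum>i<3. card ((\<lambda>x. 3 * x + i) ` T i))"
    by (subst S) (rule card_UN_le, simp)
  also have "\<dots> = (\<Sum>i<3. card (T i))"
    by (intro sum.cong refl card_image) (auto simp: inj_on_def)
  also have "\<dots> = card (T 0) + card (T 1) + card (T 2)"
    by (simp add: numeral_3_eq_3 numeral_2_eq_2)
  also have "\<dots> \<le> 2 * 2 ^ k"
  proof (cases "T 0 = {} \<or> T 1 = {} \<or> T 2 = {}")
    case True
    with T[of 0] T[of 1] T[of 2] show ?thesis by auto
  next
    case False
    then obtain a b c where abc: "3 * a + 0 \<in> S" "3 * b + 1 \<in> S" "3 * c + 2 \<in> S"
      unfolding T_def by blast
    have "(3 * a + 0) mod 3 = 0" "(3 * b + 1) mod 3 = 1" "(3 * c + 2) mod 3 = 2" by presburger+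
    then have "triangle_power (Suc k) (3 * a + 0) (3 * b + 1)"
      "triangle_power (Suc k) (3 * b + 1) (3 * c + 2)"
      "triangle_power (Suc k) (3 * c + 2) (3 * a + 0)"
      unfolding triangle_power.simps by simp_all
    then have "r (3 * a + 0) < r (3 * b + 1)" "r (3 * b + 1) < r (3 * c + 2)"
      "r (3 * c + 2) < r (3 * a + 0)"
      using abc Suc.prems(2) by blast+
    then show ?thesis by linarith
  qed
  finally show ?case by simp
qed

text \<open>Each of the \<open>c\<close> colour classes has at most \<open>2 ^ k\<close> vertices,
  too few to cover all \<open>3 ^ k\<close>.\<close>

lemma triangle_power_not_ranked_dicolouring:
  assumes "c * 2 ^ k < 3 ^ k"
  shows "\<not> ranked_dicolouring {..<3 ^ k} {(u, v). u < 3 ^ k \<and> v < 3 ^ k \<and> triangle_power k u v} c f r"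
proof
  let ?V = "{..<3 ^ k :: nat}"
  assume col: "ranked_dicolouring ?V {(u, v). u < 3 ^ k \<and> v < 3 ^ k \<and> triangle_power k u v} c f r"
  have le: "card {v \<in> ?V. f v = i} \<le> 2 ^ k" for i
    using col by (intro card_acyclic_triangle_power_le[where r = r])
      (auto simp: ranked_dicolouring_def)
  have "?V = (\<Union>i\<in>{1..c}. {v \<in> ?V. f v = i})"
    using col by (auto simp: ranked_dicolouring_def)
  then have "card ?V = card (\<Union>i\<in>{1..c}. {v \<in> ?V. f v = i})"
    by (rule arg_cong)
  also have "\<dots> \<le> (\<Sum>i\<in>{1..c}. card {v \<in> ?V. f v = i})"
    by (rule card_UN_le) simp
  also have "\<dots> \<le> (\<Sum>i\<in>{1..c}. 2 ^ k)"
    by (intro sum_mono le)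
  finally show False using assms by simp
qed

section \<open>Counting orders along lines\<close>

text \<open>Each list without repetitions stands for a transitive tournament on its entries. With
  lists, the orders of a line are counted as permutations.\<close>

definition ordered_lines :: "'l set \<Rightarrow> ('l \<Rightarrow> 'b list) \<Rightarrow> 'b rel" where
  "ordered_lines L \<sigma> = {(\<sigma> l ! i, \<sigma> l ! j) | l i j. l \<in> L \<and> i < j \<and> j < length (\<sigma> l)}"

lemma ordered_linesI:
  "l \<in> L \<Longrightarrow> i < j \<Longrightarrow> j < length (\<sigma> l) \<Longrightarrow> (\<sigma> l ! i, \<sigma> l ! j) \<in> ordered_lines L \<sigma>"
  by (auto simp: ordered_lines_def)

text \<open>The heads \<open>x\<close> and \<open>y\<close> have the same colour. If they were
  different, each would occur later in the other list, so \<open>r x < r y\<close> and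
  \<open>r y < r x\<close>.\<close>

lemma same_colours_imp_same_order:
  fixes r :: "'b \<Rightarrow> nat"
  assumes "set xs = set ys" "distinct xs" "distinct ys" "map f xs = map f ys"
    and "sorted_wrt (\<lambda>u v. f u = f v \<longrightarrow> r u < r v) xs"
    and "sorted_wrt (\<lambda>u v. f u = f v \<longrightarrow> r u < r v) ys"
  shows "xs = ys"
  using assms
proof (induction xs arbitrary: ys)
  case (Cons x xs)
  then obtain y ys' where ys: "ys = y # ys'" by (cases ys) auto
  have f: "f x = f y" using Cons.prems(4) ys by simp
  have "x = y"
  proof (rule ccontr)
    assume "x \<noteq> y"
    then have "y \<in> set xs" "x \<in> set ys'" using Cons.prems(1) ys by auto
    then have "r x < r y" "r y < r x" using Cons.prems(5,6) ys f by auto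
    then show False by simp
  qed
  moreover have "set xs = set ys'"
    using Cons.prems(1-3) ys \<open>x = y\<close> by (auto simp: insert_ident)
  ultimately show ?case using Cons ys by auto
qed simp

text \<open>
  A choice of orders is recovered from its colouring, its rank function and the sequences of
  colours along the lines, so the orders are at most as many as these triples.
\<close>

lemma orders_le_colour_codes:
  fixes V :: "'b set" and line :: "'l \<Rightarrow> 'b set"
  assumes "finite V" "finite L"
    and line: "\<And>l. l \<in> L \<Longrightarrow> line l \<subseteq> V \<and> card (line l) = n"
    and col: "\<And>\<sigma>. \<sigma> \<in> (\<Pi>\<^sub>E l\<in>L. permutations_of_set (line l)) \<Longrightarrow>
      \<exists>f r. ranked_dicolouring V (ordered_lines L \<sigma>) c f r"
  shows "fact n ^ card L \<le> (c ^ card V * card V ^ card V) * (c ^ n) ^ card L"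
proof -
  let ?O = "\<Pi>\<^sub>E l\<in>L. permutations_of_set (line l)"
  let ?C = "((\<Pi>\<^sub>E v\<in>V. {1..c}) \<times> (\<Pi>\<^sub>E v\<in>V. {..<card V}))
    \<times> (\<Pi>\<^sub>E l\<in>L. {cs. set cs \<subseteq> {1..c} \<and> length cs = n})"
  obtain f r where fr: "\<And>\<sigma>. \<sigma> \<in> ?O \<Longrightarrow> ranked_dicolouring V (ordered_lines L \<sigma>) c (f \<sigma>) (r \<sigma>)"
    using col by metis
  \<comment> \<open>The restrictions place the codes in finite function spaces, whose sizes give the
    right-hand side.\<close>
  define code where "code \<sigma> =
    ((restrict (f \<sigma>) V, restrict (r \<sigma>) V), restrict (\<lambda>l. map (f \<sigma>) (\<sigma> l)) L)" for \<sigma>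
  have order: "set (\<sigma> l) = line l" "distinct (\<sigma> l)" "length (\<sigma> l) = n"
    "sorted_wrt (\<lambda>u v. f \<sigma> u = f \<sigma> v \<longrightarrow> r \<sigma> u < r \<sigma> v) (\<sigma> l)"
    if "\<sigma> \<in> ?O" "l \<in> L" for \<sigma> l
  proof -
    have "\<sigma> l \<in> permutations_of_set (line l)" using that by (auto simp: PiE_iff)
    then show "set (\<sigma> l) = line l" "distinct (\<sigma> l)" "length (\<sigma> l) = n"
      using line[OF that(2)] by (auto simp: length_finite_permutations_of_set dest: permutations_of_setD)
    \<comment> \<open>Arcs run from earlier to later entries of a line, so ranks increase along the
      entries of one colour.\<close>
    show "sorted_wrt (\<lambda>u v. f \<sigma> u = f \<sigma> v \<longrightarrow> r \<sigma> u < r \<sigma> v) (\<sigma> l)"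
      unfolding sorted_wrt_iff_nth_less
      using fr[OF that(1)] that(2) by (fastforce simp: ranked_dicolouring_def ordered_lines_def)
  qed
  have "inj_on code ?O"
  proof (rule inj_onI)
    fix \<sigma> \<tau> assume \<sigma>: "\<sigma> \<in> ?O" and \<tau>: "\<tau> \<in> ?O" and eq: "code \<sigma> = code \<tau>"
    have f: "f \<sigma> v = f \<tau> v" and r: "r \<sigma> v = r \<tau> v" if "v \<in> V" for v
      using eq that unfolding code_def by (auto dest: fun_cong[where x = v])
    show "\<sigma> = \<tau>"
    proof (rule PiE_ext[OF \<sigma> \<tau>])
      fix l assume l: "l \<in> L"
      have V: "v \<in> V" if "v \<in> set (\<tau> l)" for v
        using that order(1)[OF \<tau> l] line[OF l] by blast
      show "\<sigma> l = \<tau> l"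
      proof (rule same_colours_imp_same_order[where f = "f \<sigma>" and r = "r \<sigma>"])
        have "map (f \<sigma>) (\<sigma> l) = map (f \<tau>) (\<tau> l)"
          using eq l unfolding code_def by (auto dest: fun_cong[where x = l])
        also have "\<dots> = map (f \<sigma>) (\<tau> l)" using V f by simp
        finally show "map (f \<sigma>) (\<sigma> l) = map (f \<sigma>) (\<tau> l)" .
        show "sorted_wrt (\<lambda>u v. f \<sigma> u = f \<sigma> v \<longrightarrow> r \<sigma> u < r \<sigma> v) (\<tau> l)"
          by (rule sorted_wrt_mono_rel[OF _ order(4)[OF \<tau> l]]) (simp add: V f r)
      qed (use order[OF \<sigma> l] order[OF \<tau> l] in auto)
    qed
  qed
  moreover have "code ` ?O \<subseteq> ?C"
  proof
    fix z assume "z \<in> code ` ?O"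
    then obtain \<sigma> where \<sigma>: "\<sigma> \<in> ?O" "z = code \<sigma>" by blast
    have "f \<sigma> ` V \<subseteq> {1..c}" "r \<sigma> ` V \<subseteq> {..<card V}"
      using fr[OF \<sigma>(1)] by (simp_all add: ranked_dicolouring_def)
    moreover have "f \<sigma> ` set (\<sigma> l) \<subseteq> {1..c}" if "l \<in> L" for l
      using calculation(1) order(1)[OF \<sigma>(1) that] line[OF that] by blast
    ultimately show "z \<in> ?C"
      using order(3)[OF \<sigma>(1)] \<sigma>(2) by (auto simp: code_def image_subset_iff)
  qed
  moreover have "finite ?C"
    using assms(1,2) by (intro finite_cartesian_product finite_PiE finite_lists_length_eq) auto
  ultimately have "card ?O \<le> card ?C" by (rule card_inj_on_le)
  moreover have "card ?O = (\<Prod>l\<in>L. fact n)"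
    unfolding card_PiE[OF assms(2)]
  proof (rule prod.cong[OF refl])
    fix l assume "l \<in> L"
    with line assms(1) have "finite (line l)" "card (line l) = n" by (auto intro: finite_subset)
    then show "card (permutations_of_set (line l)) = fact n" by simp
  qed
  moreover have "card ?C = (c ^ card V * card V ^ card V) * (c ^ n) ^ card L"
    using assms(1,2) by (simp add: card_cartesian_product card_PiE card_lists_length_eq)
  ultimately show ?thesis by simp
qed

text \<open>\<open>n ^ n / fact n\<close> is one term of the series for \<open>exp n\<close>, and
  \<open>exp 1\<close> is at most 3.\<close>

lemma power_le_fact_mult: "n ^ n \<le> 3 ^ n * fact n"
proof -
  have "real n ^ n / fact n \<le> (\<Sum>k. real n ^ k / fact k)"
    using sum_le_suminf[OF summable_exp_generic[of "real n"], of "{n}"]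
    by (simp add: divide_inverse mult.commute)
  also have "\<dots> = exp (real n)"
    by (simp add: exp_def divide_inverse mult.commute)
  also have "\<dots> = exp 1 ^ n"
    by (simp flip: exp_of_nat_mult)
  also have "\<dots> \<le> 3 ^ n"
    using exp_le by (intro power_mono) auto
  finally have "real n ^ n \<le> 3 ^ n * fact n"
    by (simp add: divide_le_eq)
  then have "real (n ^ n) \<le> real (3 ^ n * fact n)" by simp
  then show ?thesis by (simp only: of_nat_le_iff)
qed

section \<open>Lines in four directions\<close>

text \<open>For \<open>d < 3\<close> the line is parallel to an axis and \<open>p\<close>,
  \<open>q\<close> are its fixed coordinates. Otherwise it is a diagonal mod \<open>n\<close>, and
  \<open>p\<close>, \<open>q\<close> are the constant differences of the other coordinates from the
  first.\<close>

fun line_point :: "nat \<Rightarrow> nat \<times> nat \<times> nat \<Rightarrow> nat \<Rightarrow> nat \<times> nat \<times> nat" where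
  "line_point n (d, p, q) x =
     (if d = 0 then (x, p, q) else if d = 1 then (p, x, q) else if d = 2 then (p, q, x)
      else (x, (x + p) mod n, (x + q) mod n))"

definition line :: "nat \<Rightarrow> nat \<times> nat \<times> nat \<Rightarrow> (nat \<times> nat \<times> nat) set" where
  "line n l = line_point n l ` {..<n}"

abbreviation lines :: "nat \<Rightarrow> (nat \<times> nat \<times> nat) set" where
  "lines n \<equiv> {..<4} \<times> {..<n} \<times> {..<n}"

abbreviation cube :: "nat \<Rightarrow> (nat \<times> nat \<times> nat) set" where
  "cube n \<equiv> {..<n} \<times> {..<n} \<times> {..<n}"

fun differing :: "nat \<times> nat \<times> nat \<Rightarrow> nat \<times> nat \<times> nat \<Rightarrow> nat set" where
  "differing (x, y, z) (x', y', z') =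
     (if x = x' then {} else {0}) \<union> (if y = y' then {} else {1}) \<union> (if z = z' then {} else {2})"

text \<open>The support of the direction \<open>d\<close>. Comparing supports takes the place of
  linear independence of the directions.\<close>

definition moving :: "nat \<Rightarrow> nat set" where
  "moving d = (if d < 3 then {d} else {0, 1, 2})"

lemma add_mod_cancel:
  fixes x p q n :: nat
  assumes "p < n" "q < n" "(x + p) mod n = (x + q) mod n"
  shows "p = q"
proof -
  have "[x + p = x + q] (mod n)" using assms(3) by (simp add: cong_def)
  then have "[p = q] (mod n)" by (simp add: cong_add_lcancel_nat)
  then show ?thesis using assms(1,2) by (simp add: cong_def)
qed

lemma line_subset_cube: "l \<in> lines n \<Longrightarrow> line n l \<subseteq> cube n"
  by (cases l) (auto simp: line_def)

lemma card_line: "card (line n l) = n"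
proof -
  have "inj_on (line_point n l) {..<n}"
    by (cases l) (auto simp: inj_on_def split: if_splits)
  then show ?thesis by (simp add: line_def card_image)
qed

lemma parallel_lines_disjoint:
  assumes "l \<in> lines n" "m \<in> lines n" "fst l = fst m" "u \<in> line n l" "u \<in> line n m"
  shows "l = m"
proof -
  obtain d p q p' q' where "l = (d, p, q)" "m = (d, p', q')"
    using assms(3) by (cases l, cases m) auto
  with assms show ?thesis
    by (auto simp: line_def split: if_splits dest: add_mod_cancel)
qed

text \<open>Distinct points have distinct parameters, and every moving coordinate is the parameter
  plus a constant mod \<open>n\<close>.\<close>

lemma differing_eq_moving:
  assumes "l \<in> lines n" "u \<in> line n l" "v \<in> line n l" "u \<noteq> v"
  shows "differing u v = moving (fst l)"
proof -
  obtain d p q where l: "l = (d, p, q)" by (cases l)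
  obtain x y where xy: "u = line_point n l x" "v = line_point n l y" "x < n" "y < n"
    using assms(2,3) by (auto simp: line_def)
  have "x \<noteq> y" using xy assms(4) by blast
  moreover have "(x + i) mod n \<noteq> (y + i) mod n" for i
    using add_mod_cancel[OF xy(3,4), of i] \<open>x \<noteq> y\<close> by (auto simp: add.commute)
  moreover have "d = 0 \<or> d = 1 \<or> d = 2 \<or> d = 3" using assms(1) l by auto
  ultimately show ?thesis using xy l by (auto simp: moving_def)
qed

lemma differing_triangle: "differing u w \<subseteq> differing u v \<union> differing v w"
  by (cases u, cases v, cases w) auto

lemma moving_inject: "d < 4 \<Longrightarrow> e < 4 \<Longrightarrow> moving d = moving e \<Longrightarrow> d = e"
  by (auto simp: moving_def split: if_splits)

text \<open>Two distinct points determine the direction through the coordinates in which they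
  differ, and the direction and one point determine the line.\<close>

lemma common_line_unique:
  assumes "l \<in> lines n" "m \<in> lines n" "{u, v} \<subseteq> line n l" "{u, v} \<subseteq> line n m" "u \<noteq> v"
  shows "l = m"
proof -
  have "differing u v = moving (fst l)" "differing u v = moving (fst m)"
    using differing_eq_moving[OF assms(1) _ _ assms(5)] differing_eq_moving[OF assms(2) _ _ assms(5)]
      assms(3,4) by blast+
  then have "moving (fst l) = moving (fst m)" by simp
  then have "fst l = fst m" using assms(1,2) by (auto intro: moving_inject)
  with assms show ?thesis using parallel_lines_disjoint[of l n m u] by blast
qed

text \<open>Among three distinct directions, either all supports are different singletons, and none
  lies in the union of the others, or one support is \<open>{0, 1, 2}\<close>, which two singletons
  cannot cover.\<close>

lemma moving_no_triangle:
  assumes "i < 4" "j < 4" "k < 4"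
    and "moving i \<subseteq> moving j \<union> moving k" "moving j \<subseteq> moving k \<union> moving i"
    and "moving k \<subseteq> moving i \<union> moving j"
  shows "i = j \<or> j = k \<or> k = i"
proof -
  have "i = 0 \<or> i = 1 \<or> i = 2 \<or> i = 3" "j = 0 \<or> j = 1 \<or> j = 2 \<or> j = 3"
    "k = 0 \<or> k = 1 \<or> k = 2 \<or> k = 3" using assms(1-3) by auto
  then show ?thesis using assms(4-6) by (elim disjE; simp add: moving_def)
qed

lemma triangle_in_line:
  assumes "l \<in> lines n" "{a, b} \<subseteq> line n l" "m \<in> lines n" "{b, c} \<subseteq> line n m"
    and "k \<in> lines n" "{c, a} \<subseteq> line n k" and "a \<noteq> b" "b \<noteq> c" "c \<noteq> a"
  shows "l = m \<and> m = k"
proof -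
  have sym: "differing u v = differing v u" for u v
    by (cases u, cases v) auto
  have d: "differing a b = moving (fst l)" "differing b c = moving (fst m)"
    "differing c a = moving (fst k)"
    using assms by (simp_all add: differing_eq_moving)
  have "fst l = fst m \<or> fst m = fst k \<or> fst k = fst l"
  proof (rule moving_no_triangle)
    show "moving (fst l) \<subseteq> moving (fst m) \<union> moving (fst k)"
      using differing_triangle[of a b c] d sym by auto
    show "moving (fst m) \<subseteq> moving (fst k) \<union> moving (fst l)"
      using differing_triangle[of b c a] d sym by auto
    show "moving (fst k) \<subseteq> moving (fst l) \<union> moving (fst m)"
      using differing_triangle[of c a b] d sym by auto
  qed (use assms in auto)
  \<comment> \<open>Any two of the three lines share a corner of the triangle, so two with the same
    direction coincide. That line then contains all three corners and hence equals the third
    line.\<close>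
  then have "l = m \<or> m = k \<or> k = l"
    using assms parallel_lines_disjoint[of _ n] by (metis insert_subset)
  then show ?thesis
    using assms common_line_unique[of _ n] by (metis insert_subset empty_subsetI)
qed

section \<open>Digraphs obtained by ordering the points of each line\<close>

definition line_orders :: "nat \<Rightarrow> (nat \<times> nat \<times> nat \<Rightarrow> (nat \<times> nat \<times> nat) list) set" where
  "line_orders n = (\<Pi>\<^sub>E l\<in>lines n. permutations_of_set (line n l))"

lemma ordered_linesE:
  assumes "\<sigma> \<in> line_orders n" "(u, v) \<in> ordered_lines (lines n) \<sigma>"
  obtains l i j where "l \<in> lines n" "{u, v} \<subseteq> line n l" "u \<noteq> v" "distinct (\<sigma> l)"
    "i < j" "j < length (\<sigma> l)" "u = \<sigma> l ! i" "v = \<sigma> l ! j"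
proof -
  obtain l i j where l: "l \<in> lines n" "i < j" "j < length (\<sigma> l)" "u = \<sigma> l ! i" "v = \<sigma> l ! j"
    using assms(2) by (auto simp: ordered_lines_def)
  moreover have "\<sigma> l \<in> permutations_of_set (line n l)"
    using assms(1) l(1) unfolding line_orders_def by (rule PiE_mem)
  then have *: "set (\<sigma> l) = line n l" "distinct (\<sigma> l)" by (auto dest: permutations_of_setD)
  moreover have "{u, v} \<subseteq> line n l" using * l nth_mem[of i "\<sigma> l"] nth_mem[of j "\<sigma> l"] by auto
  moreover have "u \<noteq> v" using * l by (simp add: nth_eq_iff_index_eq)
  ultimately show thesis using that by blast
qed

lemma ordered_lines_subset:
  assumes "\<sigma> \<in> line_orders n"
  shows "ordered_lines (lines n) \<sigma> \<subseteq> cube n \<times> cube n"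
proof (rule subrelI)
  fix u v assume "(u, v) \<in> ordered_lines (lines n) \<sigma>"
  with assms obtain l where "l \<in> lines n" "{u, v} \<subseteq> line n l" by (elim ordered_linesE)
  then show "(u, v) \<in> cube n \<times> cube n" using line_subset_cube by blast
qed

text \<open>Opposite arcs would come from the one line through both points, where only one of the
  two can be the earlier.\<close>

lemma asym_ordered_lines:
  assumes "\<sigma> \<in> line_orders n"
  shows "asym (ordered_lines (lines n) \<sigma>)"
proof (rule asymI, rule notI)
  fix u v
  assume "(u, v) \<in> ordered_lines (lines n) \<sigma>" "(v, u) \<in> ordered_lines (lines n) \<sigma>"
  from ordered_linesE[OF assms this(1)] ordered_linesE[OF assms this(2)]
  obtain l i j m i' j' where l: "l \<in> lines n" "{u, v} \<subseteq> line n l" "u \<noteq> v" "distinct (\<sigma> l)"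
      "i < j" "j < length (\<sigma> l)" "u = \<sigma> l ! i" "v = \<sigma> l ! j"
    and m: "m \<in> lines n" "{v, u} \<subseteq> line n m"
      "i' < j'" "j' < length (\<sigma> m)" "v = \<sigma> m ! i'" "u = \<sigma> m ! j'"
    by metis
  have "l = m" using l m common_line_unique[of l n m u v] by auto
  then have "i = j'" "j = i'" using l m by (auto simp: nth_eq_iff_index_eq)
  with l m show False by simp
qed

text \<open>By \<open>triangle_in_line\<close> all three arcs come from a single line, along which
  positions cannot increase cyclically.\<close>

lemma ordered_lines_no_triangle:
  assumes "\<sigma> \<in> line_orders n"
    and "(a, b) \<in> ordered_lines (lines n) \<sigma>" "(b, c) \<in> ordered_lines (lines n) \<sigma>"
  shows "(c, a) \<notin> ordered_lines (lines n) \<sigma>"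
proof
  assume ca: "(c, a) \<in> ordered_lines (lines n) \<sigma>"
  obtain l i j where l: "l \<in> lines n" "{a, b} \<subseteq> line n l" "a \<noteq> b" "distinct (\<sigma> l)"
    "i < j" "j < length (\<sigma> l)" "a = \<sigma> l ! i" "b = \<sigma> l ! j"
    using ordered_linesE[OF assms(1,2)] by metis
  obtain m i' j' where m: "m \<in> lines n" "{b, c} \<subseteq> line n m" "b \<noteq> c"
    "i' < j'" "j' < length (\<sigma> m)" "b = \<sigma> m ! i'" "c = \<sigma> m ! j'"
    using ordered_linesE[OF assms(1,3)] by metis
  obtain k i'' j'' where k: "k \<in> lines n" "{c, a} \<subseteq> line n k" "c \<noteq> a"
    "i'' < j''" "j'' < length (\<sigma> k)" "c = \<sigma> k ! i''" "a = \<sigma> k ! j''"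
    using ordered_linesE[OF assms(1) ca] by metis
  have "l = m" "m = k"
    using triangle_in_line[OF l(1,2) m(1,2) k(1,2) l(3) m(3) k(3)] by auto
  then have "j = i'" "j' = i''" "j'' = i"
    using l m k by (auto simp: nth_eq_iff_index_eq)
  with l m k show False by simp
qed

text \<open>Five neighbours of a point lie on four lines, so two of them are adjacent.\<close>

lemma ordered_lines_no_star:
  assumes \<sigma>: "\<sigma> \<in> line_orders n" and "card B \<ge> 5"
    and star: "\<And>b. b \<in> B \<Longrightarrow>
      (x, b) \<in> ordered_lines (lines n) \<sigma> \<or> (b, x) \<in> ordered_lines (lines n) \<sigma>"
  shows "\<exists>b\<in>B. \<exists>b'\<in>B. (b, b') \<in> ordered_lines (lines n) \<sigma>"
proof -
  have "\<exists>l\<in>lines n. {x, b} \<subseteq> line n l" if "b \<in> B" for b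
    using star[OF that]
  proof
    assume "(x, b) \<in> ordered_lines (lines n) \<sigma>"
    then show ?thesis using ordered_linesE[OF \<sigma>] by metis
  next
    assume "(b, x) \<in> ordered_lines (lines n) \<sigma>"
    then obtain l where "l \<in> lines n" "{b, x} \<subseteq> line n l" using ordered_linesE[OF \<sigma>] by metis
    then show ?thesis by blast
  qed
  then obtain m where m: "\<And>b. b \<in> B \<Longrightarrow> m b \<in> lines n \<and> {x, b} \<subseteq> line n (m b)"
    by metis
  have "card ((fst \<circ> m) ` B) \<le> card {..<4 :: nat}"
    using m by (intro card_mono) (auto simp: mem_Times_iff)
  then have "\<not> inj_on (fst \<circ> m) B"
    using assms(2) by (intro pigeonhole) simp
  then obtain b b' where b: "b \<in> B" "b' \<in> B" "b \<noteq> b'" "fst (m b) = fst (m b')"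
    unfolding inj_on_def comp_def by blast
  \<comment> \<open>Both lines pass through \<open>x\<close> in the same direction, so a single line
    contains \<open>b\<close> and \<open>b'\<close>.\<close>
  then have "m b = m b'"
    using m[of b] m[of b'] parallel_lines_disjoint[of "m b" n "m b'" x] by simp
  then have l: "m b \<in> lines n" "{b, b'} \<subseteq> line n (m b)"
    using m[of b] m[of b'] b by simp_all
  have "\<sigma> (m b) \<in> permutations_of_set (line n (m b))"
    using \<sigma> l(1) unfolding line_orders_def by (rule PiE_mem)
  then have "b \<in> set (\<sigma> (m b))" "b' \<in> set (\<sigma> (m b))"
    using l(2) by (auto dest: permutations_of_setD)
  then obtain i j where "i < length (\<sigma> (m b))" "j < length (\<sigma> (m b))"
    "b = \<sigma> (m b) ! i" "b' = \<sigma> (m b) ! j"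
    by (metis in_set_conv_nth)
  moreover from this b(3) have "i < j \<or> j < i" using linorder_neq_iff by blast
  ultimately have "(b, b') \<in> ordered_lines (lines n) \<sigma> \<or> (b', b) \<in> ordered_lines (lines n) \<sigma>"
    using l(1) ordered_linesI by metis
  with b show ?thesis by blast
qed

text \<open>Otherwise \<open>orders_le_colour_codes\<close> applies to all orders. After
  \<open>fact n\<close> is replaced by its lower bound, both sides are powers with exponent
  \<open>N\<close>, the number of points, and comparing the bases gives
  \<open>n ^ 4 \<le> 81 * c ^ 5 * n ^ 3\<close>.\<close>

lemma ex_line_order_not_ranked_dicolouring:
  "\<exists>n. \<exists>\<sigma>\<in>line_orders n. \<nexists>f r. ranked_dicolouring (cube n) (ordered_lines (lines n) \<sigma>) c f r"
proof (rule ccontr)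
  \<comment> \<open>The factor 81 is \<open>3 ^ 4\<close>, lost in the estimate of
    \<open>fact n\<close>. Of the five factors \<open>c\<close>, one comes from the colouring of the
    points and four from the colour sequences along lines in four directions.\<close>
  define n where "n = 81 * c ^ 5 + 1"
  define N where "N = n ^ 3"
  assume "\<not> ?thesis"
  then have "\<And>\<sigma>. \<sigma> \<in> (\<Pi>\<^sub>E l\<in>lines n. permutations_of_set (line n l)) \<Longrightarrow>
      \<exists>f r. ranked_dicolouring (cube n) (ordered_lines (lines n) \<sigma>) c f r"
    unfolding line_orders_def by blast
  then have "fact n ^ card (lines n)
      \<le> (c ^ card (cube n) * card (cube n) ^ card (cube n)) * (c ^ n) ^ card (lines n)"
    by (intro orders_le_colour_codes[where line = "line n"])
      (simp_all add: line_subset_cube card_line)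
  moreover have "card (cube n) = N" "card (lines n) = 4 * n ^ 2"
    by (simp_all add: card_cartesian_product N_def power2_eq_square power3_eq_cube)
  ultimately have orders: "fact n ^ (4 * n ^ 2) \<le> c ^ N * N ^ N * (c ^ n) ^ (4 * n ^ 2)"
    by simp
  \<comment> \<open>The \<open>4 * n ^ 2\<close> lines with \<open>n\<close> points each have
    \<open>4 * N\<close> incidences, which turns every power into one with exponent
    \<open>N\<close>.\<close>
  have nN: "(a ^ n) ^ (4 * n ^ 2) = (a ^ 4) ^ N" for a :: nat
    by (simp add: N_def power2_eq_square power3_eq_cube mult.assoc mult.left_commute flip: power_mult)
  have "(n ^ 4) ^ N = (n ^ n) ^ (4 * n ^ 2)" by (rule nN[symmetric])
  also have "\<dots> \<le> (3 ^ n * fact n) ^ (4 * n ^ 2)"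
    by (intro power_mono power_le_fact_mult) simp
  also have "\<dots> = (3 ^ 4) ^ N * fact n ^ (4 * n ^ 2)"
    by (simp only: power_mult_distrib nN)
  also have "\<dots> \<le> (3 ^ 4) ^ N * (c ^ N * N ^ N * (c ^ n) ^ (4 * n ^ 2))"
    using orders by (rule mult_left_mono) simp
  also have "\<dots> = (3 ^ 4 * (c * N * c ^ 4)) ^ N"
    by (simp only: power_mult_distrib nN)
  finally have "n ^ 4 \<le> 3 ^ 4 * (c * N * c ^ 4)"
    using power_mono_iff[of "n ^ 4" "3 ^ 4 * (c * N * c ^ 4)" N] by (simp add: n_def N_def)
  also have "\<dots> = (81 * c ^ 5) * n ^ 3"
    by (simp add: N_def mult.assoc mult.left_commute flip: power_Suc)
  also have "\<dots> < n * n ^ 3"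
    by (simp add: n_def)
  finally show False by (simp add: eval_nat_numeral)
qed

section \<open>The two cases: \<open>H\<close> is not a tournament, or \<open>H\<close> contains a
  directed triangle\<close>

theorem theorem1p5:
  fixes F H :: "'a pair_pre_digraph" and t :: nat
  assumes "t \<ge> 5"
    and "oriented_star t F"
    and "oriented_digraph H"
    and "dichi_finite {H, F}"
  shows "transitive_tournament H"
proof -
  have F: "oriented_digraph F" using assms(2) by (simp add: oriented_star_def)
  have wf: "pair_wf_digraph K" if "K \<in> {H, F}" for K
  proof -
    have "oriented_digraph K" using that F assms(3) by blast
    then interpret oriented_digraph K .
    show ?thesis by unfold_locales
  qed
  obtain x B where star: "x \<in> pverts F" "B \<subseteq> pverts F" "card B = t"
      "\<And>b. b \<in> B \<Longrightarrow> (x, b) \<in> parcs F \<or> (b, x) \<in> parcs F"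
      "\<And>b b'. b \<in> B \<Longrightarrow> b' \<in> B \<Longrightarrow> (b, b') \<notin> parcs F"
    using oriented_star_parcs[OF assms(2)] by blast
  have "tournament H"
  proof (rule ccontr)
    assume "\<not> tournament H"
    then have nonadj_H: "\<exists>u\<in>pverts H. \<exists>v\<in>pverts H. u \<noteq> v \<and> (u, v) \<notin> parcs H \<and> (v, u) \<notin> parcs H"
      using tournament_parcs[OF assms(3)] by blast
    \<comment> \<open>Two leaves of the star show that \<open>F\<close>, like \<open>H\<close>, has
      a nonadjacent pair of vertices.\<close>
    have "\<not> card B \<le> 1" using star(3) assms(1) by simp
    then obtain b b' where "b \<in> B" "b' \<in> B" "b \<noteq> b'"
      by (metis card_le_Suc0_iff_eq One_nat_def card.infinite zero_le_one)
    then have "\<exists>u\<in>pverts F. \<exists>v\<in>pverts F. u \<noteq> v \<and> (u, v) \<notin> parcs F \<and> (v, u) \<notin> parcs F"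
      using star(2,5) by blast
    with nonadj_H have nonadj: "\<exists>u\<in>pverts K. \<exists>v\<in>pverts K. u \<noteq> v \<and> (u, v) \<notin> parcs K \<and> (v, u) \<notin> parcs K"
      if "K \<in> {H, F}" for K using that by blast
    obtain c where c: "\<And>(V :: nat set) R. \<lbrakk>finite V; R \<subseteq> V \<times> V; asym R;
        \<And>K. K \<in> {H, F} \<Longrightarrow> \<not> embeds K V R\<rbrakk> \<Longrightarrow> \<exists>f r. ranked_dicolouring V R c f r"
      using dichi_finite_ranked_dicolouring[OF assms(4) wf] by blast
    \<comment> \<open>The vertices outnumber the largest acyclic sets by a factor
      \<open>(3 / 2) ^ k\<close>, which is unbounded.\<close>
    obtain k where "real c < (3 / 2) ^ k" using real_arch_pow[of "3 / 2" "real c"] by auto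
    then have "real (c * 2 ^ k) < real (3 ^ k)" by (simp add: field_simps)
    then have k: "c * 2 ^ k < 3 ^ k" by (simp only: of_nat_less_iff)
    let ?V = "{..<3 ^ k :: nat}"
    let ?R = "{(u, v). u < 3 ^ k \<and> v < 3 ^ k \<and> triangle_power k u v}"
    have "\<exists>f r. ranked_dicolouring ?V ?R c f r"
    proof (rule c)
      show "asym ?R" using triangle_power_asym by auto
      \<comment> \<open>An embedding would send a nonadjacent pair to distinct vertices of a
        tournament.\<close>
      show "\<not> embeds K ?V ?R" if K: "K \<in> {H, F}" for K
      proof
        assume "embeds K ?V ?R"
        then obtain g where g: "inj_on g (pverts K)" "g ` pverts K \<subseteq> ?V"
          "\<And>u v. u \<in> pverts K \<Longrightarrow> v \<in> pverts K \<Longrightarrow> (u, v) \<in> parcs K \<longleftrightarrow> (g u, g v) \<in> ?R"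
          unfolding embeds_def by blast
        obtain u v where uv: "u \<in> pverts K" "v \<in> pverts K" "u \<noteq> v"
          "(u, v) \<notin> parcs K" "(v, u) \<notin> parcs K"
          using nonadj[OF K] by blast
        then have "g u < 3 ^ k" "g v < 3 ^ k" "g u \<noteq> g v"
          using g(1,2) by (auto dest: inj_onD)
        with triangle_power_total g(3) uv show False by blast
      qed
    qed auto
    with triangle_power_not_ranked_dicolouring[OF k] show False by blast
  qed
  moreover have "(w, u) \<notin> parcs H" if uv: "(u, v) \<in> parcs H" and vw: "(v, w) \<in> parcs H" for u v w
  proof
    assume wu: "(w, u) \<in> parcs H"
    interpret pair_wf_digraph H using wf by simp
    have verts: "u \<in> pverts H" "v \<in> pverts H" "w \<in> pverts H"
      using uv vw in_arcsD1 in_arcsD2 by blast+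
    obtain c where c: "\<And>(V :: (nat \<times> nat \<times> nat) set) R. \<lbrakk>finite V; R \<subseteq> V \<times> V; asym R;
        \<And>K. K \<in> {H, F} \<Longrightarrow> \<not> embeds K V R\<rbrakk> \<Longrightarrow> \<exists>f r. ranked_dicolouring V R c f r"
      using dichi_finite_ranked_dicolouring[OF assms(4) wf] by blast
    obtain n \<sigma> where \<sigma>: "\<sigma> \<in> line_orders n"
      and uncol: "\<nexists>f r. ranked_dicolouring (cube n) (ordered_lines (lines n) \<sigma>) c f r"
      using ex_line_order_not_ranked_dicolouring by blast
    let ?R = "ordered_lines (lines n) \<sigma>"
    have "\<not> embeds H (cube n) ?R"
    proof
      assume "embeds H (cube n) ?R"
      then obtain g where "\<And>a b. a \<in> pverts H \<Longrightarrow> b \<in> pverts H \<Longrightarrow>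
          (a, b) \<in> parcs H \<longleftrightarrow> (g a, g b) \<in> ?R"
        unfolding embeds_def by blast
      then show False
        using ordered_lines_no_triangle[OF \<sigma>, of "g u" "g v" "g w"] uv vw wu verts by blast
    qed
    moreover have "\<not> embeds F (cube n) ?R"
    proof
      assume "embeds F (cube n) ?R"
      then obtain g where g: "inj_on g (pverts F)"
        "\<And>a b. a \<in> pverts F \<Longrightarrow> b \<in> pverts F \<Longrightarrow> (a, b) \<in> parcs F \<longleftrightarrow> (g a, g b) \<in> ?R"
        unfolding embeds_def by blast
      \<comment> \<open>The leaves go to at least five neighbours of \<open>g x\<close>, two of
        which are adjacent, whereas leaves of \<open>F\<close> are not.\<close>
      have "card (g ` B) \<ge> 5"
        using card_image[OF inj_on_subset[OF g(1) star(2)]] star(3) assms(1) by simp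
      moreover have "(g x, y) \<in> ?R \<or> (y, g x) \<in> ?R" if "y \<in> g ` B" for y
        using that star(1,2,4) g(2) by blast
      ultimately have "\<exists>y\<in>g ` B. \<exists>y'\<in>g ` B. (y, y') \<in> ?R"
        by (rule ordered_lines_no_star[OF \<sigma>])
      with g(2) star(2,5) show False by blast
    qed
    ultimately have "\<exists>f r. ranked_dicolouring (cube n) ?R c f r"
      using ordered_lines_subset[OF \<sigma>] asym_ordered_lines[OF \<sigma>] by (intro c) auto
    with uncol show False by blast
  qed
  ultimately show ?thesis by (rule tournament_transitive_if_no_triangle)
qed

end
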